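(* Let $X$ and $Y$ be coarse spaces, where $X$ admits a coarse map $X\to\mathbb{R}_+$. Then the relation "$f_0$ is coarsely homotopic to $f_1$" is an equivalence relation on the set of coarse maps $X\to Y$.
   Context: A (unital) coarse structure on a set $X$ is a collection of subsets of $X\times X$, called entourages, such that: finite unions of entourages and subsets of entourages are entourages; the union of all entourages is $X\times X$; the inverse $M^{-1}=\{(y,x):(x,y)\in M\}$ of an entourage is an entourage; the composition $M_1M_2=\{(x,z): (x,y)\in M_1,\ (y,z)\in M_2\text{ for some }y\in X\}$ of entourages is an entourage; the diagonal is an entourage. A coarse space is a set with a coarse structure. Maps $f,g\colon S\to X$ from a set $S$ to a coarse space are close if $\{(f(s),g(s)) : s\in S\}$ is an entourage. A subset $B\subseteq X$ is bounded if the inclusion $B\hookrightarrow X$ is close to a constant map. A map $f\colon X\to Y$ of coarse spaces is controlled if $f[M]=\{(f(x),f(y)):(x,y)\in M\}$ is an entourage for every entourage $M$; it is coarse if it is controlled and inverse images of bounded sets are bounded. $\mathbb{R}_+=[0,\infty)$ carries the bounded coarse structure: entourages are the subsets of the sets $\{(s,t): |s-t|<R\}$, $R\in\mathbb{R}$. The product $X\times Y$ of coarse spaces has as entourages the subsets of sets of the form $M\times N$ (with factors reordered in the obvious way), with $M\subseteq X\times X$, $N\subseteq Y\times Y$ entourages. Subsets of coarse spaces carry the restricted structure. For a coarse map $p\colon X\to\mathbb{R}_+$ the $p$-cylinder is $I_pX=\{(x,t)\in X\times\mathbb{R}_+ : t\le p(x)+1\}$, with $i_0(x)=(x,0)$ and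 $i_1(x)=(x,p(x)+1)$. Coarse maps $f_0,f_1\colon X\to Y$ are coarsely homotopic if there are a coarse map $p\colon X\to\mathbb{R}_+$ and a coarse map $H\colon I_pX\to Y$ with $f_0=H\circ i_0$ and $f_1=H\circ i_1$. *)

theory Defs
  imports "HOL-Analysis.Analysis"
begin

text \<open>
  A coarse space is a carrier set \<open>X\<close> together with its collection \<open>E\<close> of entourages.
  The empty union is among the finite unions, and \<open>M O N\<close> is the composition
  \<open>{(x, z). \<exists>y. (x, y) \<in> M \<and> (y, z) \<in> N}\<close>.
\<close>

locale coarse_space =
  fixes X :: "'a set" and E :: "('a \<times> 'a) set set"
  assumes entourages_subset: "E \<subseteq> Pow (X \<times> X)"
    and entourage_finite_Union: "\<And>\<M>. finite \<M> \<Longrightarrow> \<M> \<subseteq> E \<Longrightarrow> \<Union>\<M> \<in> E"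
    and entourage_subset: "\<And>M N. M \<in> E \<Longrightarrow> N \<subseteq> M \<Longrightarrow> N \<in> E"
    and Union_entourages: "\<Union>E = X \<times> X"
    and entourage_converse: "\<And>M. M \<in> E \<Longrightarrow> M\<inverse> \<in> E"
    and entourage_comp: "\<And>M N. M \<in> E \<Longrightarrow> N \<in> E \<Longrightarrow> M O N \<in> E"
    and entourage_diagonal: "Id_on X \<in> E"

definition close_maps :: "('a \<times> 'a) set set \<Rightarrow> 's set \<Rightarrow> ('s \<Rightarrow> 'a) \<Rightarrow> ('s \<Rightarrow> 'a) \<Rightarrow> bool" where
  "close_maps E S f g \<longleftrightarrow> (\<lambda>s. (f s, g s)) ` S \<in> E"

definition coarsely_bounded :: "'a set \<Rightarrow> ('a \<times> 'a) set set \<Rightarrow> 'a set \<Rightarrow> bool" where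
  "coarsely_bounded X E B \<longleftrightarrow>
     B \<subseteq> X \<and> (\<exists>c \<in> B \<rightarrow> X. c constant_on B \<and> close_maps E B (\<lambda>b. b) c)"

definition controlled_map ::
  "'a set \<Rightarrow> ('a \<times> 'a) set set \<Rightarrow> 'b set \<Rightarrow> ('b \<times> 'b) set set \<Rightarrow> ('a \<Rightarrow> 'b) \<Rightarrow> bool" where
  "controlled_map X E Y F f \<longleftrightarrow> f \<in> X \<rightarrow> Y \<and> (\<forall>M\<in>E. map_prod f f ` M \<in> F)"

definition coarse_map ::
  "'a set \<Rightarrow> ('a \<times> 'a) set set \<Rightarrow> 'b set \<Rightarrow> ('b \<times> 'b) set set \<Rightarrow> ('a \<Rightarrow> 'b) \<Rightarrow> bool" where
  "coarse_map X E Y F f \<longleftrightarrow>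
     controlled_map X E Y F f \<and>
     (\<forall>B. coarsely_bounded Y F B \<longrightarrow> coarsely_bounded X E (f -` B \<inter> X))"

text \<open>
  Only the values of a map on the carrier \<open>X\<close> matter. Members of the set of coarse maps are
  therefore normalised to be \<open>undefined\<close> outside \<open>X\<close>, so that equality in this set is
  equality of maps from \<open>X\<close> to \<open>Y\<close>.
\<close>

definition coarse_maps ::
  "'a set \<Rightarrow> ('a \<times> 'a) set set \<Rightarrow> 'b set \<Rightarrow> ('b \<times> 'b) set set \<Rightarrow> ('a \<Rightarrow> 'b) set" where
  "coarse_maps X E Y F = {f \<in> X \<rightarrow>\<^sub>E Y. coarse_map X E Y F f}"

definition half_line :: "real set" where
  "half_line = {0..}"

definition half_line_entourages :: "(real \<times> real) set set" where
  "half_line_entourages =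
     {M. \<exists>R. M \<subseteq> {(s, t). s \<in> half_line \<and> t \<in> half_line \<and> \<bar>s - t\<bar> < R}}"

definition prod_entourages ::
  "('a \<times> 'a) set set \<Rightarrow> ('b \<times> 'b) set set \<Rightarrow> (('a \<times> 'b) \<times> ('a \<times> 'b)) set set" where
  "prod_entourages E F =
     {L. \<exists>M\<in>E. \<exists>N\<in>F. L \<subseteq> {((x, y), (x', y')). (x, x') \<in> M \<and> (y, y') \<in> N}}"

definition restricted_entourages :: "'a set \<Rightarrow> ('a \<times> 'a) set set \<Rightarrow> ('a \<times> 'a) set set" where
  "restricted_entourages A E = {M \<in> E. M \<subseteq> A \<times> A}"

definition cylinder :: "'a set \<Rightarrow> ('a \<Rightarrow> real) \<Rightarrow> ('a \<times> real) set" where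
  "cylinder X p = {(x, t). x \<in> X \<and> t \<in> half_line \<and> t \<le> p x + 1}"

definition cylinder_entourages ::
  "'a set \<Rightarrow> ('a \<times> 'a) set set \<Rightarrow> ('a \<Rightarrow> real) \<Rightarrow> (('a \<times> real) \<times> ('a \<times> real)) set set" where
  "cylinder_entourages X E p =
     restricted_entourages (cylinder X p) (prod_entourages E half_line_entourages)"

definition cylinder_i0 :: "'a \<Rightarrow> 'a \<times> real" where
  "cylinder_i0 x = (x, 0)"

definition cylinder_i1 :: "('a \<Rightarrow> real) \<Rightarrow> 'a \<Rightarrow> 'a \<times> real" where
  "cylinder_i1 p x = (x, p x + 1)"

definition coarsely_homotopic ::
  "'a set \<Rightarrow> ('a \<times> 'a) set set \<Rightarrow> 'b set \<Rightarrow> ('b \<times> 'b) set set \<Rightarrow>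
   ('a \<Rightarrow> 'b) \<Rightarrow> ('a \<Rightarrow> 'b) \<Rightarrow> bool" where
  "coarsely_homotopic X E Y F f\<^sub>0 f\<^sub>1 \<longleftrightarrow>
     f\<^sub>0 \<in> coarse_maps X E Y F \<and> f\<^sub>1 \<in> coarse_maps X E Y F \<and>
     (\<exists>p H. coarse_map X E half_line half_line_entourages p \<and>
            coarse_map (cylinder X p) (cylinder_entourages X E p) Y F H \<and>
            (\<forall>x\<in>X. f\<^sub>0 x = (H \<circ> cylinder_i0) x) \<and>
            (\<forall>x\<in>X. f\<^sub>1 x = (H \<circ> cylinder_i1 p) x))"

end

theory Submission
  imports Defs
begin

text \<open>
  A coarse map \<open>p\<close> to the half-line is bounded on bounded sets, so a subset of the \<open>p\<close>-cylinder
  is bounded exactly when its shadow in \<open>X\<close> is. Hence the projection to \<open>X\<close> is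
  coarse (\<open>coarse_map_cylinder_fst\<close>), and a map between two cylinders that preserves the
  \<open>X\<close>-coordinate is coarse as soon as its second coordinate varies in a controlled way
  (\<open>coarse_map_over_base\<close>). All homotopies needed here arise from given maps by composing with
  such maps.

  Reflexivity: any coarse \<open>p\<close> carries the constant homotopy \<open>f \<circ> fst\<close>. Symmetry: precompose with
  the reflection \<open>(x, t) \<mapsto> (x, p x + 1 - t)\<close>. Transitivity: homotopies \<open>H\<close> and \<open>K\<close> on the
  \<open>p\<close>- and the \<open>q\<close>-cylinder are stacked on the cylinder of \<open>p + q + 1\<close>, whose height
  \<open>p + q + 2\<close> is the sum of the two heights.

  The one delicate point is that the stacked map is controlled, although it is defined by
  cases: a pair of nearby points may lie in different parts. Clamping the height extends \<open>H\<close> and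
  \<open>K\<close> to coarse maps on the whole of the stacked cylinder, each equal to the middle map \<open>f\<^sub>1 \<circ> fst\<close>
  outside its own part, and this suffices for pasting (\<open>coarse_map_paste\<close>).
\<close>

section \<open>Bounded sets and coarse maps\<close>

text \<open>
  Closure under finite unions reduces to the empty and the binary union, and the condition that
  the entourages cover \<open>X \<times> X\<close> to single pairs.
\<close>

lemma coarse_spaceI:
  assumes sub: "E \<subseteq> Pow (X \<times> X)"
    and empty: "{} \<in> E"
    and Un: "\<And>M N. M \<in> E \<Longrightarrow> N \<in> E \<Longrightarrow> M \<union> N \<in> E"
    and subset: "\<And>M N. M \<in> E \<Longrightarrow> N \<subseteq> M \<Longrightarrow> N \<in> E"
    and connected: "\<And>x y. x \<in> X \<Longrightarrow> y \<in> X \<Longrightarrow> {(x, y)} \<in> E"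
    and conv: "\<And>M. M \<in> E \<Longrightarrow> M\<inverse> \<in> E"
    and comp: "\<And>M N. M \<in> E \<Longrightarrow> N \<in> E \<Longrightarrow> M O N \<in> E"
    and diag: "Id_on X \<in> E"
  shows "coarse_space X E"
proof
  show "\<Union>\<M> \<in> E" if "finite \<M>" "\<M> \<subseteq> E" for \<M>
    using that by (induction rule: finite_induct) (auto intro: empty Un)
  show "\<Union>E = X \<times> X"
    using sub connected by blast
qed (use assms in auto)

context coarse_space
begin

lemma empty_entourage: "{} \<in> E"
  using entourage_finite_Union[of "{}"] by simp

lemma entourage_Un: "M \<in> E \<Longrightarrow> N \<in> E \<Longrightarrow> M \<union> N \<in> E"
  using entourage_finite_Union[of "{M, N}"] by simp

lemma singleton_entourage:
  assumes "x \<in> X" "y \<in> X"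
  shows "{(x, y)} \<in> E"
proof -
  have "(x, y) \<in> \<Union>E"
    using assms Union_entourages by simp
  then show ?thesis
    by (blast intro: entourage_subset)
qed

text \<open>
  Two points related to a common centre are related to each other, so the choice of a constant
  map in the definition of boundedness can be avoided.
\<close>

lemma coarsely_bounded_iff_square:
  "coarsely_bounded X E B \<longleftrightarrow> B \<subseteq> X \<and> B \<times> B \<in> E"
proof
  assume "coarsely_bounded X E B"
  then obtain c where "B \<subseteq> X" and const: "c constant_on B" and "close_maps E B (\<lambda>b. b) c"
    unfolding coarsely_bounded_def by blast
  then have M: "(\<lambda>b. (b, c b)) ` B \<in> E" (is "?M \<in> E")
    by (simp add: close_maps_def)
  have "B \<times> B \<subseteq> ?M O ?M\<inverse>"
    using const by (auto simp: constant_on_def relcomp_unfold image_iff)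
  with M \<open>B \<subseteq> X\<close> show "B \<subseteq> X \<and> B \<times> B \<in> E"
    by (meson entourage_comp entourage_converse entourage_subset)
next
  assume B: "B \<subseteq> X \<and> B \<times> B \<in> E"
  define b\<^sub>0 where "b\<^sub>0 = (SOME b. b \<in> B)"
  have b\<^sub>0: "b\<^sub>0 \<in> B" if "b \<in> B" for b
    unfolding b\<^sub>0_def using that by (rule someI)
  have "(\<lambda>b. (b, b\<^sub>0)) ` B \<in> E"
    by (rule entourage_subset[of "B \<times> B"]) (use B b\<^sub>0 in auto)
  moreover have "(\<lambda>_. b\<^sub>0) \<in> B \<rightarrow> X"
    using B b\<^sub>0 by blast
  moreover have "(\<lambda>_. b\<^sub>0) constant_on B"
    by (simp add: constant_on_def)
  ultimately show "coarsely_bounded X E B"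
    unfolding coarsely_bounded_def close_maps_def using B by blast
qed

lemma coarsely_bounded_mono:
  assumes "coarsely_bounded X E B" "A \<subseteq> B"
  shows "coarsely_bounded X E A"
proof -
  have "A \<times> A \<subseteq> B \<times> B"
    using assms(2) by blast
  with assms show ?thesis
    unfolding coarsely_bounded_iff_square using entourage_subset by blast
qed

text \<open>
  The union axiom makes every two points of \<open>X\<close> related by some entourage, so two bounded
  sets can be joined by a single pair of points.
\<close>

lemma coarsely_bounded_Un:
  assumes "coarsely_bounded X E A" "coarsely_bounded X E B"
  shows "coarsely_bounded X E (A \<union> B)"
proof (cases "A = {} \<or> B = {}")
  case True
  with assms show ?thesis
    by auto
next
  case False
  then obtain a b where a: "a \<in> A" and b: "b \<in> B"
    by blast
  have A: "A \<subseteq> X" "A \<times> A \<in> E" and B: "B \<subseteq> X" "B \<times> B \<in> E"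
    using assms by (auto simp: coarsely_bounded_iff_square)
  let ?M = "(A \<times> A) O {(a, b)} O (B \<times> B)"
  have M: "?M \<in> E"
    using a b A B by (blast intro: entourage_comp singleton_entourage)
  have eq: "?M = A \<times> B"
    using a b by auto
  have "(A \<times> A \<union> B \<times> B) \<union> (?M \<union> ?M\<inverse>) \<in> E"
    using A B M by (intro entourage_Un entourage_converse)
  then have "(A \<union> B) \<times> (A \<union> B) \<in> E"
    by (rule entourage_subset) (auto simp: eq)
  then show ?thesis
    using A B by (simp add: coarsely_bounded_iff_square)
qed

end

lemma controlled_mapD:
  "controlled_map X E Y F f \<Longrightarrow> M \<in> E \<Longrightarrow> map_prod f f ` M \<in> F"
  by (simp add: controlled_map_def)

lemma coarsely_bounded_controlled_image:
  assumes "coarse_space X E" "coarse_space Y F"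
    and f: "controlled_map X E Y F f" and B: "coarsely_bounded X E B"
  shows "coarsely_bounded Y F (f ` B)"
proof -
  have "B \<subseteq> X" "B \<times> B \<in> E"
    using B coarse_space.coarsely_bounded_iff_square[OF assms(1)] by auto
  moreover have "map_prod f f ` (B \<times> B) = f ` B \<times> f ` B"
    by (simp add: map_prod_surj_on)
  ultimately have "f ` B \<times> f ` B \<in> F" "f ` B \<subseteq> Y"
    using controlled_mapD[OF f, of "B \<times> B"] f by (auto simp: controlled_map_def)
  then show ?thesis
    using coarse_space.coarsely_bounded_iff_square[OF assms(2)] by simp
qed

lemma coarse_map_comp:
  assumes f: "coarse_map X E Y F f" and g: "coarse_map Y F Z G g"
  shows "coarse_map X E Z G (g \<circ> f)"
  unfolding coarse_map_def controlled_map_def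
proof (intro conjI ballI allI impI)
  show "g \<circ> f \<in> X \<rightarrow> Z"
    using f g by (auto simp: coarse_map_def controlled_map_def)
  show "map_prod (g \<circ> f) (g \<circ> f) ` M \<in> G" if "M \<in> E" for M
  proof -
    have "map_prod g g ` map_prod f f ` M \<in> G"
      using f g that by (simp add: coarse_map_def controlled_map_def)
    then show ?thesis
      by (simp add: image_comp map_prod_compose)
  qed
  show "coarsely_bounded X E ((g \<circ> f) -` B \<inter> X)" if "coarsely_bounded Z G B" for B
  proof -
    have "coarsely_bounded Y F (g -` B \<inter> Y)"
      using g that by (simp add: coarse_map_def)
    then have "coarsely_bounded X E (f -` (g -` B \<inter> Y) \<inter> X)"
      using f unfolding coarse_map_def by blast
    moreover have "f -` (g -` B \<inter> Y) \<inter> X = (g \<circ> f) -` B \<inter> X"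
      using f by (auto simp: coarse_map_def controlled_map_def)
    ultimately show ?thesis
      by simp
  qed
qed

section \<open>Pasting coarse maps\<close>

text \<open>
  Let \<open>h\<close> be given by \<open>g\<^sub>1\<close> on \<open>A\<close> and by \<open>g\<^sub>2\<close> off \<open>A\<close>. A pair of related points \<open>a\<close> in \<open>A\<close> and
  \<open>b\<close> off \<open>A\<close> need not be near the interface of the two pieces, but their images are
  nevertheless related, by the chain
  \<open>g\<^sub>1 a \<sim> g\<^sub>1 b = k b \<sim> k a = g\<^sub>2 a \<sim> g\<^sub>2 b\<close>,
  since each piece is continued by the same map \<open>k\<close> on the other part.
\<close>

lemma coarse_map_paste:
  assumes Z: "coarse_space Z G" and Y: "coarse_space Y F"
    and g\<^sub>1: "coarse_map Z G Y F g\<^sub>1" and g\<^sub>2: "coarse_map Z G Y F g\<^sub>2"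
    and k: "controlled_map Z G Y F k"
    and g\<^sub>2_k: "\<And>z. z \<in> Z \<Longrightarrow> z \<in> A \<Longrightarrow> g\<^sub>2 z = k z"
    and g\<^sub>1_k: "\<And>z. z \<in> Z \<Longrightarrow> z \<notin> A \<Longrightarrow> g\<^sub>1 z = k z"
  shows "coarse_map Z G Y F (\<lambda>z. if z \<in> A then g\<^sub>1 z else g\<^sub>2 z)"
    (is "coarse_map Z G Y F ?h")
proof -
  interpret Z: coarse_space Z G by (rule Z)
  interpret Y: coarse_space Y F by (rule Y)
  have "map_prod ?h ?h ` M \<in> F" if M: "M \<in> G" for M
  proof -
    let ?M\<^sub>1 = "map_prod g\<^sub>1 g\<^sub>1 ` M" and ?M\<^sub>2 = "map_prod g\<^sub>2 g\<^sub>2 ` M"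
    let ?K = "(map_prod k k ` M)\<inverse>"
    let ?N = "(?M\<^sub>1 \<union> ?M\<^sub>2) \<union> (?M\<^sub>1 O ?K O ?M\<^sub>2 \<union> ?M\<^sub>2 O ?K O ?M\<^sub>1)"
    have "?M\<^sub>1 \<in> F" "?M\<^sub>2 \<in> F" "map_prod k k ` M \<in> F"
      using g\<^sub>1 g\<^sub>2 k M by (auto simp: coarse_map_def controlled_map_def)
    then have N: "?N \<in> F"
      by (intro Y.entourage_Un Y.entourage_comp Y.entourage_converse)
    have MZ: "M \<subseteq> Z \<times> Z"
      using M Z.entourages_subset by blast
    have "(?h a, ?h b) \<in> ?N" if ab: "(a, b) \<in> M" for a b
    proof -
      have Z: "a \<in> Z" "b \<in> Z"
        using ab MZ by auto
      have 1: "(g\<^sub>1 a, g\<^sub>1 b) \<in> ?M\<^sub>1" and 2: "(g\<^sub>2 a, g\<^sub>2 b) \<in> ?M\<^sub>2" and 3: "(k b, k a) \<in> ?K"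
        using ab by auto
      consider "a \<in> A" "b \<in> A" | "a \<notin> A" "b \<notin> A" | "a \<in> A" "b \<notin> A" | "a \<notin> A" "b \<in> A"
        by blast
      then show ?thesis
      proof cases
        case 3
        with Z have eq: "g\<^sub>1 b = k b" "g\<^sub>2 a = k a"
          by (auto intro: g\<^sub>1_k g\<^sub>2_k)
        have "(g\<^sub>1 a, g\<^sub>2 b) \<in> ?M\<^sub>1 O ?K O ?M\<^sub>2"
          using 1 2 \<open>(k b, k a) \<in> ?K\<close> unfolding eq by (intro relcompI)
        with 3 show ?thesis
          by simp
      next
        case 4
        with Z have eq: "g\<^sub>2 b = k b" "g\<^sub>1 a = k a"
          by (auto intro: g\<^sub>1_k g\<^sub>2_k)
        have "(g\<^sub>2 a, g\<^sub>1 b) \<in> ?M\<^sub>2 O ?K O ?M\<^sub>1"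
          using 1 2 3 unfolding eq by (intro relcompI)
        with 4 show ?thesis
          by simp
      qed (use 1 2 in simp_all)
    qed
    then have "map_prod ?h ?h ` M \<subseteq> ?N"
      by (auto simp del: Un_iff)
    with N show ?thesis
      by (rule Y.entourage_subset)
  qed
  moreover have "coarsely_bounded Z G (?h -` B \<inter> Z)" if "coarsely_bounded Y F B" for B
  proof -
    have "coarsely_bounded Z G ((g\<^sub>1 -` B \<inter> Z) \<union> (g\<^sub>2 -` B \<inter> Z))"
      using g\<^sub>1 g\<^sub>2 that by (simp add: coarse_map_def Z.coarsely_bounded_Un)
    then show ?thesis
      by (rule Z.coarsely_bounded_mono) (auto split: if_splits)
  qed
  moreover have "?h \<in> Z \<rightarrow> Y"
    using g\<^sub>1 g\<^sub>2 by (auto simp: coarse_map_def controlled_map_def)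
  ultimately show ?thesis
    by (simp add: coarse_map_def controlled_map_def)
qed

section \<open>The half-line, products and subspaces\<close>

lemma half_line_entouragesI:
  "(\<And>s t. (s, t) \<in> M \<Longrightarrow> s \<ge> 0 \<and> t \<ge> 0 \<and> \<bar>s - t\<bar> < R) \<Longrightarrow> M \<in> half_line_entourages"
  by (force simp: half_line_entourages_def half_line_def)

lemma half_line_entouragesE:
  assumes "M \<in> half_line_entourages"
  obtains R where "\<And>s t. (s, t) \<in> M \<Longrightarrow> s \<ge> 0 \<and> t \<ge> 0 \<and> \<bar>s - t\<bar> < R"
  using assms by (force simp: half_line_entourages_def half_line_def)

lemma coarse_space_half_line: "coarse_space half_line half_line_entourages"
proof (rule coarse_spaceI)
  fix M N :: "(real \<times> real) set"
  assume M: "M \<in> half_line_entourages" and N: "N \<in> half_line_entourages"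
  obtain R where R: "\<And>s t. (s, t) \<in> M \<Longrightarrow> s \<ge> 0 \<and> t \<ge> 0 \<and> \<bar>s - t\<bar> < R"
    using M by (rule half_line_entouragesE) blast
  obtain S where S: "\<And>s t. (s, t) \<in> N \<Longrightarrow> s \<ge> 0 \<and> t \<ge> 0 \<and> \<bar>s - t\<bar> < S"
    using N by (rule half_line_entouragesE) blast
  show "M \<union> N \<in> half_line_entourages"
    by (rule half_line_entouragesI[where R = "max R S"])
      (use R S in \<open>fastforce simp: less_max_iff_disj\<close>)
  show "M O N \<in> half_line_entourages"
    by (rule half_line_entouragesI[where R = "R + S"]) (use R S in fastforce)
next
  fix M :: "(real \<times> real) set"
  assume M: "M \<in> half_line_entourages"
  then obtain R where R: "\<And>s t. (s, t) \<in> M \<Longrightarrow> s \<ge> 0 \<and> t \<ge> 0 \<and> \<bar>s - t\<bar> < R"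
    by (rule half_line_entouragesE) blast
  show "M\<inverse> \<in> half_line_entourages"
    by (rule half_line_entouragesI[where R = R]) (use R in \<open>fastforce simp: abs_minus_commute\<close>)
  show "N \<in> half_line_entourages" if "N \<subseteq> M" for N
    by (rule half_line_entouragesI[where R = R]) (use R that in blast)
next
  fix x y :: real
  assume "x \<in> half_line" "y \<in> half_line"
  then show "{(x, y)} \<in> half_line_entourages"
    by (intro half_line_entouragesI[where R = "\<bar>x - y\<bar> + 1"]) (auto simp: half_line_def)
next
  show "Id_on half_line \<in> half_line_entourages"
    by (rule half_line_entouragesI[where R = 1]) (auto simp: half_line_def)
next
  show "half_line_entourages \<subseteq> Pow (half_line \<times> half_line)"
    unfolding half_line_entourages_def by blast
  show "{} \<in> half_line_entourages"
    by (rule half_line_entouragesI) simp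
qed

lemma coarsely_bounded_half_line_iff:
  "coarsely_bounded half_line half_line_entourages B \<longleftrightarrow> (\<exists>R. B \<subseteq> {0..R})"
proof -
  have "(B \<subseteq> half_line \<and> B \<times> B \<in> half_line_entourages) \<longleftrightarrow> (\<exists>R. B \<subseteq> {0..R})"
  proof
    assume B: "B \<subseteq> half_line \<and> B \<times> B \<in> half_line_entourages"
    then have "B \<times> B \<in> half_line_entourages" ..
    then obtain R where R: "\<And>s t. (s, t) \<in> B \<times> B \<Longrightarrow> s \<ge> 0 \<and> t \<ge> 0 \<and> \<bar>s - t\<bar> < R"
      by (rule half_line_entouragesE) blast
    show "\<exists>R. B \<subseteq> {0..R}"
    proof (cases "B = {}")
      case False
      then obtain b where "b \<in> B"
        by blast
      then have "B \<subseteq> {0..b + R}"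
        using R by fastforce
      then show ?thesis ..
    qed simp
  next
    assume "\<exists>R. B \<subseteq> {0..R}"
    then obtain R where R: "B \<subseteq> {0..R}" ..
    have "B \<times> B \<in> half_line_entourages"
    proof (rule half_line_entouragesI[where R = "R + 1"])
      fix s t assume "(s, t) \<in> B \<times> B"
      then have "s \<in> {0..R}" "t \<in> {0..R}"
        using R by auto
      then show "s \<ge> 0 \<and> t \<ge> 0 \<and> \<bar>s - t\<bar> < R + 1"
        by auto
    qed
    then show "B \<subseteq> half_line \<and> B \<times> B \<in> half_line_entourages"
      using R by (auto simp: half_line_def)
  qed
  then show ?thesis
    using coarse_space.coarsely_bounded_iff_square[OF coarse_space_half_line] by simp
qed

lemma prod_entouragesI:
  assumes "M \<in> E" "N \<in> F"
    and "\<And>x y x' y'. ((x, y), (x', y')) \<in> L \<Longrightarrow> (x, x') \<in> M \<and> (y, y') \<in> N"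
  shows "L \<in> prod_entourages E F"
proof -
  have "L \<subseteq> {((x, y), (x', y')). (x, x') \<in> M \<and> (y, y') \<in> N}"
    by (auto dest: assms(3))
  with assms(1,2) show ?thesis
    unfolding prod_entourages_def by blast
qed

lemma prod_entouragesE:
  assumes "L \<in> prod_entourages E F"
  obtains M N where "M \<in> E" "N \<in> F"
    "\<And>x y x' y'. ((x, y), (x', y')) \<in> L \<Longrightarrow> (x, x') \<in> M \<and> (y, y') \<in> N"
proof -
  obtain M N where "M \<in> E" "N \<in> F"
    and L: "L \<subseteq> {((x, y), (x', y')). (x, x') \<in> M \<and> (y, y') \<in> N}"
    using assms unfolding prod_entourages_def by blast
  from this(1,2) show ?thesis
    by (rule that) (drule subsetD[OF L], simp)
qed

lemma coarse_space_prod: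
  assumes "coarse_space X E" "coarse_space Y F"
  shows "coarse_space (X \<times> Y) (prod_entourages E F)"
proof -
  interpret X: coarse_space X E by (rule assms)
  interpret Y: coarse_space Y F by (rule assms)
  show ?thesis
  proof (rule coarse_spaceI)
    show "prod_entourages E F \<subseteq> Pow ((X \<times> Y) \<times> (X \<times> Y))"
      using X.entourages_subset Y.entourages_subset unfolding prod_entourages_def by fastforce
    show "{} \<in> prod_entourages E F"
      by (rule prod_entouragesI[OF X.empty_entourage Y.empty_entourage]) simp
  next
    fix L L' assume "L \<in> prod_entourages E F" "L' \<in> prod_entourages E F"
    then obtain M N M' N' where E: "M \<in> E" "M' \<in> E" and F: "N \<in> F" "N' \<in> F"
      and L: "\<And>x y x' y'. ((x, y), (x', y')) \<in> L \<Longrightarrow> (x, x') \<in> M \<and> (y, y') \<in> N"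
      and L': "\<And>x y x' y'. ((x, y), (x', y')) \<in> L' \<Longrightarrow> (x, x') \<in> M' \<and> (y, y') \<in> N'"
      by (elim prod_entouragesE) blast
    show "L \<union> L' \<in> prod_entourages E F"
      by (rule prod_entouragesI[OF X.entourage_Un[OF E] Y.entourage_Un[OF F]])
        (use L L' in blast)
    show "L O L' \<in> prod_entourages E F"
      by (rule prod_entouragesI[OF X.entourage_comp[OF E] Y.entourage_comp[OF F]])
        (use L L' in fast)
  next
    fix L L' assume "L \<in> prod_entourages E F" "L' \<subseteq> L"
    then show "L' \<in> prod_entourages E F"
      unfolding prod_entourages_def by blast
  next
    fix L assume "L \<in> prod_entourages E F"
    then obtain M N where "M \<in> E" "N \<in> F"
      and L: "\<And>x y x' y'. ((x, y), (x', y')) \<in> L \<Longrightarrow> (x, x') \<in> M \<and> (y, y') \<in> N"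
      by (rule prod_entouragesE) blast
    then show "L\<inverse> \<in> prod_entourages E F"
      by (intro prod_entouragesI[OF X.entourage_converse[of M] Y.entourage_converse[of N]]) auto
  next
    fix z w assume "z \<in> X \<times> Y" "w \<in> X \<times> Y"
    then show "{(z, w)} \<in> prod_entourages E F"
      by (intro prod_entouragesI[of "{(fst z, fst w)}" _ "{(snd z, snd w)}"]
          X.singleton_entourage Y.singleton_entourage) auto
  next
    show "Id_on (X \<times> Y) \<in> prod_entourages E F"
      by (rule prod_entouragesI[OF X.entourage_diagonal Y.entourage_diagonal]) auto
  qed
qed

lemma coarse_space_restricted:
  assumes "coarse_space X E" "A \<subseteq> X"
  shows "coarse_space A (restricted_entourages A E)"
proof -
  interpret coarse_space X E by fact
  show ?thesis
  proof (rule coarse_spaceI)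
    show "{} \<in> restricted_entourages A E"
      by (simp add: restricted_entourages_def empty_entourage)
    show "restricted_entourages A E \<subseteq> Pow (A \<times> A)"
      unfolding restricted_entourages_def by blast
    show "Id_on A \<in> restricted_entourages A E"
      using entourage_subset[OF entourage_diagonal, of "Id_on A"] assms(2)
      unfolding restricted_entourages_def by blast
    show "{(x, y)} \<in> restricted_entourages A E" if "x \<in> A" "y \<in> A" for x y
      using that assms(2) singleton_entourage[of x y] unfolding restricted_entourages_def by blast
  next
    fix M N assume "M \<in> restricted_entourages A E" "N \<in> restricted_entourages A E"
    then have M: "M \<in> E" "M \<subseteq> A \<times> A" and N: "N \<in> E" "N \<subseteq> A \<times> A"
      by (simp_all add: restricted_entourages_def)
    show "M \<union> N \<in> restricted_entourages A E"
      using M N by (simp add: restricted_entourages_def entourage_Un)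
    have "M O N \<subseteq> A \<times> A"
      using M N by blast
    with M N show "M O N \<in> restricted_entourages A E"
      by (simp add: restricted_entourages_def entourage_comp)
  next
    fix M assume "M \<in> restricted_entourages A E"
    then have M: "M \<in> E" "M \<subseteq> A \<times> A"
      by (simp_all add: restricted_entourages_def)
    have "M\<inverse> \<subseteq> A \<times> A"
      using M by blast
    with M show "M\<inverse> \<in> restricted_entourages A E"
      by (simp add: restricted_entourages_def entourage_converse)
    show "N \<in> restricted_entourages A E" if "N \<subseteq> M" for N
      using that M entourage_subset[of M N] by (simp add: restricted_entourages_def)
  qed
qed

section \<open>Cylinders\<close>

lemma mem_cylinder_iff: "(x, t) \<in> cylinder X p \<longleftrightarrow> x \<in> X \<and> 0 \<le> t \<and> t \<le> p x + 1"
  by (auto simp: cylinder_def half_line_def)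

lemma coarse_space_cylinder:
  assumes "coarse_space X E"
  shows "coarse_space (cylinder X p) (cylinder_entourages X E p)"
  unfolding cylinder_entourages_def
  by (rule coarse_space_restricted[OF coarse_space_prod[OF assms coarse_space_half_line]])
    (auto simp: cylinder_def)

lemma cylinder_entouragesI:
  assumes "M \<in> E"
    and "\<And>x t y s. ((x, t), (y, s)) \<in> L \<Longrightarrow>
      (x, y) \<in> M \<and> (x, t) \<in> cylinder X p \<and> (y, s) \<in> cylinder X p \<and> \<bar>t - s\<bar> < R"
  shows "L \<in> cylinder_entourages X E p"
proof -
  have "{(t, s). 0 \<le> t \<and> 0 \<le> s \<and> \<bar>t - s\<bar> < R} \<in> half_line_entourages"
    by (rule half_line_entouragesI[where R = R]) auto
  with assms(1) have "L \<in> prod_entourages E half_line_entourages"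
    by (rule prod_entouragesI) (drule assms(2), simp add: mem_cylinder_iff)
  moreover have "L \<subseteq> cylinder X p \<times> cylinder X p"
    by (rule subrelI, clarify, drule assms(2)) simp
  ultimately show ?thesis
    by (simp add: cylinder_entourages_def restricted_entourages_def)
qed

lemma cylinder_entouragesE:
  assumes "L \<in> cylinder_entourages X E p"
  obtains M R where "M \<in> E"
    "\<And>x t y s. ((x, t), (y, s)) \<in> L \<Longrightarrow>
      (x, y) \<in> M \<and> (x, t) \<in> cylinder X p \<and> (y, s) \<in> cylinder X p \<and> \<bar>t - s\<bar> < R"
proof -
  have "L \<subseteq> cylinder X p \<times> cylinder X p"
    and "L \<in> prod_entourages E half_line_entourages"
    using assms by (auto simp: cylinder_entourages_def restricted_entourages_def)
  then obtain M N where "M \<in> E" and N: "N \<in> half_line_entourages"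
    and L: "\<And>x t y s. ((x, t), (y, s)) \<in> L \<Longrightarrow> (x, y) \<in> M \<and> (t, s) \<in> N"
    by (elim prod_entouragesE) blast
  obtain R where R: "\<And>t s. (t, s) \<in> N \<Longrightarrow> t \<ge> 0 \<and> s \<ge> 0 \<and> \<bar>t - s\<bar> < R"
    using N by (rule half_line_entouragesE) blast
  show ?thesis
  proof (rule that[OF \<open>M \<in> E\<close>])
    fix x t y s assume "((x, t), (y, s)) \<in> L"
    then show "(x, y) \<in> M \<and> (x, t) \<in> cylinder X p \<and> (y, s) \<in> cylinder X p \<and> \<bar>t - s\<bar> < R"
      using L[of x t y s] R[of t s] \<open>L \<subseteq> _\<close> by blast
  qed
qed

lemma controlled_half_lineE:
  assumes "controlled_map X E half_line half_line_entourages p" "M \<in> E"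
  obtains R where "\<And>x y. (x, y) \<in> M \<Longrightarrow> \<bar>p x - p y\<bar> < R"
proof -
  have "map_prod p p ` M \<in> half_line_entourages"
    using assms by (rule controlled_mapD)
  then obtain R where "\<And>s t. (s, t) \<in> map_prod p p ` M \<Longrightarrow> s \<ge> 0 \<and> t \<ge> 0 \<and> \<bar>s - t\<bar> < R"
    by (rule half_line_entouragesE) blast
  then show ?thesis
    by (intro that[of R]) force
qed

text \<open>
  A controlled \<open>p\<close> is bounded on bounded sets, so the height of the cylinder over a bounded
  set is bounded. Hence the boundedness of a subset of the cylinder only depends on its shadow
  in \<open>X\<close>.
\<close>

lemma coarse_map_cylinder_fst:
  assumes X: "coarse_space X E" and p: "controlled_map X E half_line half_line_entourages p"
  shows "coarse_map (cylinder X p) (cylinder_entourages X E p) X E fst"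
  unfolding coarse_map_def controlled_map_def
proof (intro conjI ballI allI impI)
  interpret X: coarse_space X E by (rule X)
  show "fst \<in> cylinder X p \<rightarrow> X"
    by (auto simp: cylinder_def)
  show "map_prod fst fst ` L \<in> E" if L: "L \<in> cylinder_entourages X E p" for L
  proof -
    obtain M R where "M \<in> E" and M: "\<And>x t y s. ((x, t), (y, s)) \<in> L \<Longrightarrow>
      (x, y) \<in> M \<and> (x, t) \<in> cylinder X p \<and> (y, s) \<in> cylinder X p \<and> \<bar>t - s\<bar> < R"
      using L by (rule cylinder_entouragesE) blast
    have "map_prod fst fst ` L \<subseteq> M"
      using M by fastforce
    with \<open>M \<in> E\<close> show ?thesis
      by (rule X.entourage_subset)
  qed
  show "coarsely_bounded (cylinder X p) (cylinder_entourages X E p) (fst -` B \<inter> cylinder X p)"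
    (is "coarsely_bounded _ _ ?C") if B: "coarsely_bounded X E B" for B
  proof -
    have "coarsely_bounded half_line half_line_entourages (p ` B)"
      using X coarse_space_half_line p B by (rule coarsely_bounded_controlled_image)
    then obtain R where R: "p ` B \<subseteq> {0..R}"
      unfolding coarsely_bounded_half_line_iff by blast
    have "B \<times> B \<in> E"
      using B X.coarsely_bounded_iff_square by blast
    then have "?C \<times> ?C \<in> cylinder_entourages X E p"
    proof (rule cylinder_entouragesI[where R = "R + 2"])
      fix x t y s assume "((x, t), (y, s)) \<in> ?C \<times> ?C"
      then have *: "x \<in> B" "y \<in> B" "(x, t) \<in> cylinder X p" "(y, s) \<in> cylinder X p"
        by auto
      moreover have "p x \<le> R" "p y \<le> R"
        using R * by auto
      ultimately show "(x, y) \<in> B \<times> B \<and> (x, t) \<in> cylinder X p \<and> (y, s) \<in> cylinder X p \<and>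
          \<bar>t - s\<bar> < R + 2"
        by (auto simp: mem_cylinder_iff)
    qed
    then show ?thesis
      using coarse_space.coarsely_bounded_iff_square[OF coarse_space_cylinder[OF X]] by simp
  qed
qed

text \<open>
  For a map of cylinders over \<open>X\<close> properness is automatic: the shadow of a preimage is
  contained in the shadow of the original bounded set.
\<close>

lemma coarse_map_over_base:
  assumes X: "coarse_space X E"
    and q: "controlled_map X E half_line half_line_entourages q"
    and p: "controlled_map X E half_line half_line_entourages p"
    and range: "\<And>x t. (x, t) \<in> cylinder X q \<Longrightarrow> (x, g x t) \<in> cylinder X p"
    and g: "\<And>M R. M \<in> E \<Longrightarrow> \<exists>S. \<forall>x y t s. (x, y) \<in> M \<and> \<bar>t - s\<bar> < R \<longrightarrow> \<bar>g x t - g y s\<bar> < S"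
  shows "coarse_map (cylinder X q) (cylinder_entourages X E q)
    (cylinder X p) (cylinder_entourages X E p) (\<lambda>(x, t). (x, g x t))"
    (is "coarse_map _ _ _ _ ?g")
  unfolding coarse_map_def controlled_map_def
proof (intro conjI ballI allI impI)
  interpret Q: coarse_space "cylinder X q" "cylinder_entourages X E q"
    using X by (rule coarse_space_cylinder)
  show "?g \<in> cylinder X q \<rightarrow> cylinder X p"
    using range by auto
  show "map_prod ?g ?g ` L \<in> cylinder_entourages X E p"
    if L: "L \<in> cylinder_entourages X E q" for L
  proof -
    obtain M R where "M \<in> E" and M: "\<And>x t y s. ((x, t), (y, s)) \<in> L \<Longrightarrow>
      (x, y) \<in> M \<and> (x, t) \<in> cylinder X q \<and> (y, s) \<in> cylinder X q \<and> \<bar>t - s\<bar> < R"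
      using L by (rule cylinder_entouragesE) blast
    obtain S where S: "\<forall>x y t s. (x, y) \<in> M \<and> \<bar>t - s\<bar> < R \<longrightarrow> \<bar>g x t - g y s\<bar> < S"
      using g[OF \<open>M \<in> E\<close>] by blast
    show ?thesis
    proof (rule cylinder_entouragesI[OF \<open>M \<in> E\<close>, where R = S])
      fix x t y s assume "((x, t), (y, s)) \<in> map_prod ?g ?g ` L"
      then obtain t' s' where L: "((x, t'), (y, s')) \<in> L" and "t = g x t'" "s = g y s'"
        by auto
      then show "(x, y) \<in> M \<and> (x, t) \<in> cylinder X p \<and> (y, s) \<in> cylinder X p \<and> \<bar>t - s\<bar> < S"
        using M[OF L] S range by simp
    qed
  qed
  show "coarsely_bounded (cylinder X q) (cylinder_entourages X E q) (?g -` B \<inter> cylinder X q)"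
    if B: "coarsely_bounded (cylinder X p) (cylinder_entourages X E p) B" for B
  proof -
    have "controlled_map (cylinder X p) (cylinder_entourages X E p) X E fst"
      using coarse_map_cylinder_fst[OF X p] by (simp add: coarse_map_def)
    then have "coarsely_bounded X E (fst ` B)"
      using B coarse_space_cylinder[OF X] X by (blast intro: coarsely_bounded_controlled_image)
    then have "coarsely_bounded (cylinder X q) (cylinder_entourages X E q)
        (fst -` (fst ` B) \<inter> cylinder X q)"
      using coarse_map_cylinder_fst[OF X q] by (simp add: coarse_map_def)
    then show ?thesis
      by (rule Q.coarsely_bounded_mono) (clarsimp, erule rev_image_eqI, simp)
  qed
qed

section \<open>Operations on coarse homotopies\<close>

lemma coarsely_homotopicI:
  assumes "f\<^sub>0 \<in> coarse_maps X E Y F" "f\<^sub>1 \<in> coarse_maps X E Y F"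
    and "coarse_map X E half_line half_line_entourages p"
    and "coarse_map (cylinder X p) (cylinder_entourages X E p) Y F H"
    and "\<And>x. x \<in> X \<Longrightarrow> H (x, 0) = f\<^sub>0 x"
    and "\<And>x. x \<in> X \<Longrightarrow> H (x, p x + 1) = f\<^sub>1 x"
  shows "coarsely_homotopic X E Y F f\<^sub>0 f\<^sub>1"
  unfolding coarsely_homotopic_def cylinder_i0_def cylinder_i1_def comp_def
  by (intro conjI exI[of _ p] exI[of _ H] ballI assms(1-4) assms(5,6)[symmetric])

lemma coarsely_homotopicE:
  assumes "coarsely_homotopic X E Y F f\<^sub>0 f\<^sub>1"
  obtains p H where "f\<^sub>0 \<in> coarse_maps X E Y F" "f\<^sub>1 \<in> coarse_maps X E Y F"
    and "coarse_map X E half_line half_line_entourages p"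
    and "coarse_map (cylinder X p) (cylinder_entourages X E p) Y F H"
    and "\<And>x. x \<in> X \<Longrightarrow> H (x, 0) = f\<^sub>0 x"
    and "\<And>x. x \<in> X \<Longrightarrow> H (x, p x + 1) = f\<^sub>1 x"
proof -
  obtain p H where "f\<^sub>0 \<in> coarse_maps X E Y F" "f\<^sub>1 \<in> coarse_maps X E Y F"
    and "coarse_map X E half_line half_line_entourages p"
    and "coarse_map (cylinder X p) (cylinder_entourages X E p) Y F H"
    and "\<forall>x\<in>X. f\<^sub>0 x = H (x, 0)" "\<forall>x\<in>X. f\<^sub>1 x = H (x, p x + 1)"
    using assms unfolding coarsely_homotopic_def cylinder_i0_def cylinder_i1_def comp_def by blast
  then show ?thesis
    by (intro that[of p H]) simp_all
qed

lemma coarsely_homotopic_refl: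
  assumes X: "coarse_space X E"
    and p: "coarse_map X E half_line half_line_entourages p"
    and f: "f \<in> coarse_maps X E Y F"
  shows "coarsely_homotopic X E Y F f f"
proof -
  have "coarse_map (cylinder X p) (cylinder_entourages X E p) Y F (f \<circ> fst)"
    using coarse_map_cylinder_fst[OF X] p f
    by (intro coarse_map_comp) (auto simp: coarse_map_def coarse_maps_def)
  with f p show ?thesis
    by (auto intro: coarsely_homotopicI)
qed

lemma coarsely_homotopic_sym:
  assumes X: "coarse_space X E" and "coarsely_homotopic X E Y F f\<^sub>0 f\<^sub>1"
  shows "coarsely_homotopic X E Y F f\<^sub>1 f\<^sub>0"
  using assms(2)
proof (rule coarsely_homotopicE)
  fix p H
  assume f: "f\<^sub>0 \<in> coarse_maps X E Y F" "f\<^sub>1 \<in> coarse_maps X E Y F"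
    and p: "coarse_map X E half_line half_line_entourages p"
    and H: "coarse_map (cylinder X p) (cylinder_entourages X E p) Y F H"
    and H0: "\<And>x. x \<in> X \<Longrightarrow> H (x, 0) = f\<^sub>0 x"
    and H1: "\<And>x. x \<in> X \<Longrightarrow> H (x, p x + 1) = f\<^sub>1 x"
  have pc: "controlled_map X E half_line half_line_entourages p"
    using p by (simp add: coarse_map_def)
  let ?flip = "\<lambda>(x, t). (x, p x + 1 - t)"
  have "coarse_map (cylinder X p) (cylinder_entourages X E p)
      (cylinder X p) (cylinder_entourages X E p) ?flip"
  proof (rule coarse_map_over_base[OF X pc pc])
    fix M R assume "M \<in> E"
    obtain P where P: "\<And>x y. (x, y) \<in> M \<Longrightarrow> \<bar>p x - p y\<bar> < P"
      using pc \<open>M \<in> E\<close> by (rule controlled_half_lineE) blast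
    show "\<exists>S. \<forall>x y t s. (x, y) \<in> M \<and> \<bar>t - s\<bar> < R \<longrightarrow> \<bar>(p x + 1 - t) - (p y + 1 - s)\<bar> < S"
      by (intro exI[of _ "P + R"] allI impI) (elim conjE, drule P, linarith)
  qed (auto simp: mem_cylinder_iff)
  then have "coarse_map (cylinder X p) (cylinder_entourages X E p) Y F (H \<circ> ?flip)"
    using H by (rule coarse_map_comp)
  with f p show ?thesis
    by (intro coarsely_homotopicI[where p = p and H = "H \<circ> ?flip"]) (auto simp: H0 H1)
qed

text \<open>
  A sum of nonnegative functions bounds its first summand, so preimages of bounded sets only
  shrink.
\<close>

lemma coarse_map_half_line_add:
  assumes X: "coarse_space X E"
    and p: "coarse_map X E half_line half_line_entourages p"
    and q: "coarse_map X E half_line half_line_entourages q"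
    and "c \<ge> 0"
  shows "coarse_map X E half_line half_line_entourages (\<lambda>x. p x + q x + c)"
    (is "coarse_map _ _ _ _ ?r")
  unfolding coarse_map_def controlled_map_def
proof (intro conjI ballI allI impI)
  interpret X: coarse_space X E by (rule X)
  have pc: "controlled_map X E half_line half_line_entourages p"
    and qc: "controlled_map X E half_line half_line_entourages q"
    using p q by (simp_all add: coarse_map_def)
  then have p0: "\<And>x. x \<in> X \<Longrightarrow> p x \<ge> 0" and q0: "\<And>x. x \<in> X \<Longrightarrow> q x \<ge> 0"
    by (auto simp: controlled_map_def half_line_def)
  show "?r \<in> X \<rightarrow> half_line"
    using p0 q0 \<open>c \<ge> 0\<close> by (auto simp: half_line_def)
  show "map_prod ?r ?r ` M \<in> half_line_entourages" if M: "M \<in> E" for M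
  proof -
    obtain P where P: "\<And>x y. (x, y) \<in> M \<Longrightarrow> \<bar>p x - p y\<bar> < P"
      using pc M by (rule controlled_half_lineE) blast
    obtain Q where Q: "\<And>x y. (x, y) \<in> M \<Longrightarrow> \<bar>q x - q y\<bar> < Q"
      using qc M by (rule controlled_half_lineE) blast
    have MX: "M \<subseteq> X \<times> X"
      using M X.entourages_subset by blast
    show ?thesis
    proof (rule half_line_entouragesI[where R = "P + Q"])
      fix s t assume "(s, t) \<in> map_prod ?r ?r ` M"
      then obtain x y where xy: "(x, y) \<in> M" "s = ?r x" "t = ?r y"
        by auto
      then have "x \<in> X" "y \<in> X"
        using MX by auto
      with xy P[of x y] Q[of x y] p0[of x] p0[of y] q0[of x] q0[of y] \<open>c \<ge> 0\<close>
      show "s \<ge> 0 \<and> t \<ge> 0 \<and> \<bar>s - t\<bar> < P + Q"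
        by auto
    qed
  qed
  show "coarsely_bounded X E (?r -` B \<inter> X)"
    if B: "coarsely_bounded half_line half_line_entourages B" for B
  proof -
    obtain R where R: "B \<subseteq> {0..R}"
      using B unfolding coarsely_bounded_half_line_iff by blast
    have "coarsely_bounded half_line half_line_entourages {0..R}"
      unfolding coarsely_bounded_half_line_iff by blast
    then have "coarsely_bounded X E (p -` {0..R} \<inter> X)"
      using p by (simp add: coarse_map_def)
    then show ?thesis
    proof (rule X.coarsely_bounded_mono)
      show "?r -` B \<inter> X \<subseteq> p -` {0..R} \<inter> X"
      proof
        fix x assume x: "x \<in> ?r -` B \<inter> X"
        then have "?r x \<in> {0..R}"
          using R by blast
        with x show "x \<in> p -` {0..R} \<inter> X"
          using p0[of x] q0[of x] \<open>c \<ge> 0\<close> by simp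
      qed
    qed
  qed
qed

text \<open>
  The cylinder with height \<open>(p + 1) + (q + 1)\<close> is the \<open>p\<close>-cylinder with the \<open>q\<close>-cylinder
  stacked on top. It retracts onto the lower part by cutting the height at \<open>p + 1\<close>, and onto
  the upper part by lifting everything below to the bottom of the \<open>q\<close>-cylinder. On the part
  that is squashed, either homotopy then takes the value of the common middle map \<open>f\<^sub>1\<close>, which
  is what pasting requires.
\<close>

lemma coarsely_homotopic_trans:
  assumes X: "coarse_space X E" and Y: "coarse_space Y F"
    and "coarsely_homotopic X E Y F f\<^sub>0 f\<^sub>1" and "coarsely_homotopic X E Y F f\<^sub>1 f\<^sub>2"
  shows "coarsely_homotopic X E Y F f\<^sub>0 f\<^sub>2"
proof -
  obtain p H where f\<^sub>0: "f\<^sub>0 \<in> coarse_maps X E Y F" and f\<^sub>1: "f\<^sub>1 \<in> coarse_maps X E Y F"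
    and p: "coarse_map X E half_line half_line_entourages p"
    and H: "coarse_map (cylinder X p) (cylinder_entourages X E p) Y F H"
    and H0: "\<And>x. x \<in> X \<Longrightarrow> H (x, 0) = f\<^sub>0 x"
    and H1: "\<And>x. x \<in> X \<Longrightarrow> H (x, p x + 1) = f\<^sub>1 x"
    using assms(3) by (rule coarsely_homotopicE) blast
  obtain q K where f\<^sub>2: "f\<^sub>2 \<in> coarse_maps X E Y F"
    and q: "coarse_map X E half_line half_line_entourages q"
    and K: "coarse_map (cylinder X q) (cylinder_entourages X E q) Y F K"
    and K0: "\<And>x. x \<in> X \<Longrightarrow> K (x, 0) = f\<^sub>1 x"
    and K1: "\<And>x. x \<in> X \<Longrightarrow> K (x, q x + 1) = f\<^sub>2 x"
    using assms(4) by (rule coarsely_homotopicE) blast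
  define r where "r = (\<lambda>x. p x + q x + 1)"
  have r: "coarse_map X E half_line half_line_entourages r"
    unfolding r_def using X p q by (rule coarse_map_half_line_add) simp
  have pc: "controlled_map X E half_line half_line_entourages p"
    and qc: "controlled_map X E half_line half_line_entourages q"
    and rc: "controlled_map X E half_line half_line_entourages r"
    using p q r by (simp_all add: coarse_map_def)
  then have p0: "\<And>x. x \<in> X \<Longrightarrow> p x \<ge> 0" and q0: "\<And>x. x \<in> X \<Longrightarrow> q x \<ge> 0"
    by (auto simp: controlled_map_def half_line_def)

  let ?low = "\<lambda>(x, t). (x, min t (p x + 1))" and ?up = "\<lambda>(x, t). (x, max 0 (t - (p x + 1)))"
  have low: "coarse_map (cylinder X r) (cylinder_entourages X E r)
      (cylinder X p) (cylinder_entourages X E p) ?low"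
  proof (rule coarse_map_over_base[OF X rc pc])
    fix M R assume "M \<in> E"
    obtain P where P: "\<And>x y. (x, y) \<in> M \<Longrightarrow> \<bar>p x - p y\<bar> < P"
      using pc \<open>M \<in> E\<close> by (rule controlled_half_lineE) blast
    show "\<exists>S. \<forall>x y t s. (x, y) \<in> M \<and> \<bar>t - s\<bar> < R \<longrightarrow> \<bar>min t (p x + 1) - min s (p y + 1)\<bar> < S"
      by (intro exI[of _ "P + R"] allI impI) (elim conjE, drule P, linarith)
  qed (auto simp: mem_cylinder_iff p0)
  have up: "coarse_map (cylinder X r) (cylinder_entourages X E r)
      (cylinder X q) (cylinder_entourages X E q) ?up"
  proof (rule coarse_map_over_base[OF X rc qc])
    fix M R assume "M \<in> E"
    obtain P where P: "\<And>x y. (x, y) \<in> M \<Longrightarrow> \<bar>p x - p y\<bar> < P"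
      using pc \<open>M \<in> E\<close> by (rule controlled_half_lineE) blast
    show "\<exists>S. \<forall>x y t s. (x, y) \<in> M \<and> \<bar>t - s\<bar> < R \<longrightarrow>
        \<bar>max 0 (t - (p x + 1)) - max 0 (s - (p y + 1))\<bar> < S"
      by (intro exI[of _ "P + R"] allI impI) (elim conjE, drule P, linarith)
  qed (auto simp: mem_cylinder_iff q0 r_def)

  let ?A = "{(x, t). t \<le> p x + 1}"
  let ?L = "\<lambda>z. if z \<in> ?A then (H \<circ> ?low) z else (K \<circ> ?up) z"
  have "coarse_map (cylinder X r) (cylinder_entourages X E r) Y F ?L"
  proof (rule coarse_map_paste)
    show "coarse_space (cylinder X r) (cylinder_entourages X E r)"
      using X by (rule coarse_space_cylinder)
    show "coarse_map (cylinder X r) (cylinder_entourages X E r) Y F (H \<circ> ?low)"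
      using low H by (rule coarse_map_comp)
    show "coarse_map (cylinder X r) (cylinder_entourages X E r) Y F (K \<circ> ?up)"
      using up K by (rule coarse_map_comp)
    have "coarse_map (cylinder X r) (cylinder_entourages X E r) Y F (f\<^sub>1 \<circ> fst)"
      using coarse_map_cylinder_fst[OF X rc] f\<^sub>1
      by (intro coarse_map_comp) (auto simp: coarse_maps_def)
    then show "controlled_map (cylinder X r) (cylinder_entourages X E r) Y F (f\<^sub>1 \<circ> fst)"
      by (simp add: coarse_map_def)
  qed (use Y in \<open>auto simp: mem_cylinder_iff min_def max_def H1 K0\<close>)
  with f\<^sub>0 f\<^sub>2 r show ?thesis
  proof (rule coarsely_homotopicI)
    show "?L (x, 0) = f\<^sub>0 x" if "x \<in> X" for x
      using that p0[of x] by (simp add: min_def H0)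
    show "?L (x, r x + 1) = f\<^sub>2 x" if "x \<in> X" for x
    proof -
      have "r x + 1 - (p x + 1) = q x + 1" "\<not> r x + 1 \<le> p x + 1"
        using q0[OF that] by (auto simp: r_def)
      then show ?thesis
        using that q0[OF that] by (simp add: K1)
    qed
  qed
qed

theorem theorem2p4:
  fixes X :: "'a set" and E :: "('a \<times> 'a) set set"
    and Y :: "'b set" and F :: "('b \<times> 'b) set set"
  assumes "coarse_space X E"
    and "coarse_space Y F"
    and "\<exists>p. coarse_map X E half_line half_line_entourages p"
  shows "equiv (coarse_maps X E Y F) {(f\<^sub>0, f\<^sub>1). coarsely_homotopic X E Y F f\<^sub>0 f\<^sub>1}"
proof (rule equivI)
  show "{(f\<^sub>0, f\<^sub>1). coarsely_homotopic X E Y F f\<^sub>0 f\<^sub>1}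
      \<subseteq> coarse_maps X E Y F \<times> coarse_maps X E Y F"
    by (auto simp: coarsely_homotopic_def)
  show "refl_on (coarse_maps X E Y F) {(f\<^sub>0, f\<^sub>1). coarsely_homotopic X E Y F f\<^sub>0 f\<^sub>1}"
    using assms by (auto intro!: refl_onI coarsely_homotopic_refl)
  show "sym {(f\<^sub>0, f\<^sub>1). coarsely_homotopic X E Y F f\<^sub>0 f\<^sub>1}"
    using assms by (auto intro!: symI intro: coarsely_homotopic_sym)
  show "trans {(f\<^sub>0, f\<^sub>1). coarsely_homotopic X E Y F f\<^sub>0 f\<^sub>1}"
    using assms by (auto intro!: transI intro: coarsely_homotopic_trans)
qed

end
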